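(* Let $Y = \log X$ and let $\epsilon >0$. Then all but $O\left(\dfrac{X}{(\log \log \log X)^{1-\epsilon}}\right)$ fundamental discriminants $D$ with $|D| < X$ satisfy $$\omega_Y(D) \geq \log \log \log X - O\left((\log \log \log X)^{1 -\epsilon}\right).$$
   Context: For an integer $D$, $\omega_Y(D)=\#\{p\le Y: p \text{ prime},\ p\mid D\}$.
   Formalization: The range 1/2 ≤ ε < 1 is excluded: there the claim is false, since ω_Y(D) is asymptotically normal with mean and variance log log log X + O(1), so a positive proportion of D violates the inequality. All other ε > 0 are covered. *)

theory Defs
  imports
    "HOL-Library.Landau_Symbols"
    "HOL-Computational_Algebra.Computational_Algebra"
    "HOL-Number_Theory.Cong"
begin

(* The usual convention that 1 is a fundamental discriminant is adopted. *)
definition fundamental_discriminant :: "int \<Rightarrow> bool" where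
  "fundamental_discriminant D \<longleftrightarrow>
     ([D = 1] (mod 4) \<and> squarefree D) \<or>
     (\<exists>m. D = 4 * m \<and> ([m = 2] (mod 4) \<or> [m = 3] (mod 4)) \<and> squarefree m)"

definition omega_upto :: "real \<Rightarrow> int \<Rightarrow> nat" where
  "omega_upto Y D = card {p :: nat. prime p \<and> real p \<le> Y \<and> int p dvd D}"

end

(* All integers |D| < X are counted, not only fundamental discriminants. With y = sqrt (log X) the
   product of the primes p <= y is at most X, so X can be rounded up to a multiple M <= 2X of that
   product. On the interval [-M, M) divisibility by the primes p <= y is exactly independent, hence
   the mean of z^\<omega>_y(n) is the product of the factors 1 + (z - 1)/p. Together with
   sum_{p <= y} 1/p >= log log y - log 2, Rankin's trick with z = 1 - L^(-\<epsilon>)/4, L = log log log X,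
   bounds the number of n with \<omega>_y(n) < L - L^(1 - \<epsilon>) by O(X exp (- L^(1 - 2\<epsilon>)/8)); this
   suffices when \<epsilon> < 1/2, whereas a second moment would only give O(X / L^(1 - 2\<epsilon>)). For
   \<epsilon> >= 1 the trivial bound O(X) suffices. *)

theory Submission
  imports Defs "HOL-Analysis.Harmonic_Numbers" "HOL-Real_Asymp.Real_Asymp"
begin

section \<open>Exact independence of divisibility by finitely many primes\<close>

lemma prod_primes_dvd_iff:
  fixes T :: "nat set"
  assumes "finite T" "\<And>p. p \<in> T \<Longrightarrow> prime p"
  shows "int (\<Prod>T) dvd n \<longleftrightarrow> (\<forall>p\<in>T. int p dvd n)"
  using assms
proof (induction T rule: finite_induct)
  case (insert p T)
  have "coprime p (\<Prod>T)"
    by (rule prod_coprime_right) (use insert in \<open>auto intro!: primes_coprime\<close>)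
  hence cop: "coprime (int p) (int (\<Prod>T))"
    by (simp only: coprime_int_iff)
  have "int (\<Prod>(insert p T)) dvd n \<longleftrightarrow> int p * int (\<Prod>T) dvd n"
    using insert by simp
  also have "\<dots> \<longleftrightarrow> int p dvd n \<and> int (\<Prod>T) dvd n"
    using cop by (meson divides_mult dvd_mult_left dvd_mult_right)
  finally show ?case
    using insert by auto
qed auto

text \<open>The endpoints are multiples of \<open>d\<close> and the interval is half-open, so the
  count has no rounding error; the exactness of the mean value of \<open>z ^ \<omega>\<close> rests
  on this.\<close>

lemma card_multiples:
  fixes d K :: nat
  assumes "d > 0"
  shows "card {n \<in> {- int (d * K)..<int (d * K)}. int d dvd n} = 2 * K"
proof -
  have "{n \<in> {- int (d * K)..<int (d * K)}. int d dvd n} = (\<lambda>k. int d * k) ` {- int K..<int K}"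
  proof (intro set_eqI iffI)
    fix n assume "n \<in> {n \<in> {- int (d * K)..<int (d * K)}. int d dvd n}"
    then obtain k where k: "n = int d * k" "int d * (- int K) \<le> int d * k" "int d * k < int d * int K"
      by auto
    have "- int K \<le> k" "k < int K"
      using k assms by (simp_all only: mult_le_cancel_left_pos mult_less_cancel_left_pos of_nat_0_less_iff)
    thus "n \<in> (\<lambda>k. int d * k) ` {- int K..<int K}"
      using k by auto
  next
    fix n assume "n \<in> (\<lambda>k. int d * k) ` {- int K..<int K}"
    then obtain k where k: "n = int d * k" "- int K \<le> k" "k < int K"
      by (metis (no_types, lifting) atLeastLessThan_iff imageE)
    have "int d * (- int K) \<le> int d * k" "int d * k < int d * int K"
      using k assms by (simp_all only: mult_le_cancel_left_pos mult_less_cancel_left_pos of_nat_0_less_iff)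
    thus "n \<in> {n \<in> {- int (d * K)..<int (d * K)}. int d dvd n}"
      using k by auto
  qed
  also have "card \<dots> = card {- int K..<int K}"
    using assms by (intro card_image) (auto simp: inj_on_def)
  finally show ?thesis
    by simp
qed

text \<open>Writing z = (z - 1) + 1 at each prime dividing n and expanding over subsets T of
  \<open>S\<close> leaves the condition that the product of T divides n. That product divides
  \<open>M\<close>, so exactly 2M / (product of T) integers n satisfy it, and the sum over T factors
  again.\<close>

lemma sum_power_card_prime_divisors:
  fixes S :: "nat set" and z :: real
  assumes S: "finite S" "\<And>p. p \<in> S \<Longrightarrow> prime p" and M: "\<Prod>S dvd M"
  shows "(\<Sum>n\<in>{- int M..<int M}. z ^ card {p\<in>S. int p dvd n})
           = 2 * real M * (\<Prod>p\<in>S. 1 + (z - 1) / real p)"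
proof -
  have expand: "z ^ card {p\<in>S. int p dvd n}
      = (\<Sum>T\<in>Pow S. if int (\<Prod>T) dvd n then (z - 1) ^ card T else 0)" for n
  proof -
    have "z ^ card {p\<in>S. int p dvd n} = (\<Prod>p\<in>S. if int p dvd n then z else 1)"
      using S(1) by (subst prod.inter_filter [symmetric]) auto
    also have "\<dots> = (\<Prod>p\<in>S. (if int p dvd n then z - 1 else 0) + 1)"
      by (intro prod.cong) auto
    also have "\<dots> = (\<Sum>T\<in>Pow S. \<Prod>p\<in>T. if int p dvd n then z - 1 else 0)"
      using S(1) by (subst prod_add) auto
    also have "\<dots> = (\<Sum>T\<in>Pow S. if int (\<Prod>T) dvd n then (z - 1) ^ card T else 0)"
    proof (intro sum.cong refl)
      fix T assume "T \<in> Pow S"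
      hence T: "finite T" "\<And>p. p \<in> T \<Longrightarrow> prime p"
        using S finite_subset by auto
      show "(\<Prod>p\<in>T. if int p dvd n then z - 1 else 0)
              = (if int (\<Prod>T) dvd n then (z - 1) ^ card T else 0)"
        using T(1) by (subst prod_primes_dvd_iff[OF T]) auto
    qed
    finally show ?thesis .
  qed
  have "(\<Sum>n\<in>{- int M..<int M}. z ^ card {p\<in>S. int p dvd n})
      = (\<Sum>T\<in>Pow S. \<Sum>n\<in>{- int M..<int M}. if int (\<Prod>T) dvd n then (z - 1) ^ card T else 0)"
    unfolding expand by (rule sum.swap)
  also have "\<dots> = (\<Sum>T\<in>Pow S. 2 * real M * (\<Prod>p\<in>T. (z - 1) / real p))"
  proof (intro sum.cong refl)
    fix T assume T: "T \<in> Pow S"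
    have pos: "\<Prod>T > 0"
      using T S(2) by (intro prod_pos) (auto dest: prime_gt_0_nat)
    have "\<Prod>T dvd \<Prod>S"
      using T S(1) by (intro prod_dvd_prod_subset) auto
    with M obtain K where K: "M = \<Prod>T * K"
      by (meson dvd_def dvd_trans)
    have "(\<Sum>n\<in>{- int M..<int M}. if int (\<Prod>T) dvd n then (z - 1) ^ card T else 0)
        = real (card {n \<in> {- int M..<int M}. int (\<Prod>T) dvd n}) * (z - 1) ^ card T"
      by (subst sum.inter_filter [symmetric]) auto
    also have "card {n \<in> {- int M..<int M}. int (\<Prod>T) dvd n} = 2 * K"
      unfolding K by (rule card_multiples[OF pos])
    also have "real (2 * K) * (z - 1) ^ card T = 2 * real M * (\<Prod>p\<in>T. (z - 1) / real p)"
    proof -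
      have "real (\<Prod>T) \<noteq> 0"
        using pos by (simp del: of_nat_prod)
      moreover have "(\<Prod>p\<in>T. (z - 1) / real p) = (z - 1) ^ card T / real (\<Prod>T)"
        by (simp add: prod_dividef)
      moreover have "real M = real (\<Prod>T) * real K"
        unfolding K by (rule of_nat_mult)
      ultimately show ?thesis
        by (simp del: of_nat_prod)
    qed
    finally show "(\<Sum>n\<in>{- int M..<int M}. if int (\<Prod>T) dvd n then (z - 1) ^ card T else 0)
        = 2 * real M * (\<Prod>p\<in>T. (z - 1) / real p)" .
  qed
  also have "\<dots> = 2 * real M * (\<Prod>p\<in>S. (z - 1) / real p + 1)"
    using S(1) by (subst prod_add) (auto simp: sum_distrib_left)
  finally show ?thesis
    by (simp add: add.commute)
qed

section \<open>Rankin's bound for integers with few prime divisors\<close>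

text \<open>Give n the weight \<open>(1 - \<eta>) ^ card {p\<in>S. int p dvd n}\<close>. Every
  counted n has weight at least exp (- k (\<eta> + 2 \<eta>^2)), so the count is at most the total
  weight over [-M, M) divided by this; 1 + x \<le> exp x turns the Euler product for the total into
  an exponential.\<close>

lemma card_few_prime_divisors_le:
  fixes S :: "nat set" and k \<eta> :: real
  assumes S: "finite S" "\<And>p. p \<in> S \<Longrightarrow> prime p" and M: "\<Prod>S dvd M"
    and k: "k \<ge> 0" and \<eta>: "0 \<le> \<eta>" "\<eta> \<le> 1 / 2"
  shows "real (card {n \<in> {- int M..<int M}. real (card {p\<in>S. int p dvd n}) < k})
           \<le> 2 * real M * exp (k * (\<eta> + 2 * \<eta>\<^sup>2) - \<eta> * (\<Sum>p\<in>S. 1 / real p))"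
proof -
  let ?E = "{n \<in> {- int M..<int M}. real (card {p\<in>S. int p dvd n}) < k}"
  let ?a = "exp (- (k * (\<eta> + 2 * \<eta>\<^sup>2)))"
  have "real (card ?E) * ?a = (\<Sum>n\<in>?E. ?a)"
    by simp
  also have "\<dots> \<le> (\<Sum>n\<in>?E. (1 - \<eta>) ^ card {p\<in>S. int p dvd n})"
  proof (rule sum_mono)
    fix n assume n: "n \<in> ?E"
    let ?w = "card {p\<in>S. int p dvd n}"
    have "- (k * (\<eta> + 2 * \<eta>\<^sup>2)) \<le> real ?w * (- \<eta> - 2 * \<eta>\<^sup>2)"
      using n \<eta> mult_right_mono[of "real ?w" k "\<eta> + 2 * \<eta>\<^sup>2"] by (simp add: algebra_simps)
    \<comment> \<open>The bound ln (1 - \<eta>) \<ge> - \<eta> - 2 \<eta>^2 is where \<eta> \<le>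
      1/2 enters.\<close>
    also have "\<dots> \<le> real ?w * ln (1 - \<eta>)"
      using \<eta> by (intro mult_left_mono ln_one_minus_pos_lower_bound) auto
    finally have "?a \<le> exp (real ?w * ln (1 - \<eta>))"
      by simp
    also have "\<dots> = (1 - \<eta>) ^ ?w"
      using \<eta> by (simp add: exp_of_nat_mult)
    finally show "?a \<le> (1 - \<eta>) ^ ?w" .
  qed
  also have "\<dots> \<le> (\<Sum>n\<in>{- int M..<int M}. (1 - \<eta>) ^ card {p\<in>S. int p dvd n})"
    using \<eta> by (intro sum_mono2) auto
  also have "\<dots> = 2 * real M * (\<Prod>p\<in>S. 1 + (1 - \<eta> - 1) / real p)"
    by (rule sum_power_card_prime_divisors[OF S M])
  also have "\<dots> \<le> 2 * real M * (\<Prod>p\<in>S. exp (- \<eta> / real p))"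
  proof (intro mult_left_mono prod_mono conjI)
    fix p assume "p \<in> S"
    hence "real p \<ge> 1"
      using S(2) prime_gt_0_nat by (simp add: Suc_leI)
    thus "0 \<le> 1 + (1 - \<eta> - 1) / real p"
      using \<eta> by (simp add: field_simps)
    show "1 + (1 - \<eta> - 1) / real p \<le> exp (- \<eta> / real p)"
      using exp_ge_add_one_self[of "- \<eta> / real p"] by simp
  qed auto
  also have "(\<Prod>p\<in>S. exp (- \<eta> / real p)) = exp (- \<eta> * (\<Sum>p\<in>S. 1 / real p))"
    using S(1) by (subst exp_sum [symmetric]) (auto simp: sum_distrib_left)
  finally have "real (card ?E) \<le> 2 * real M * exp (- \<eta> * (\<Sum>p\<in>S. 1 / real p)) / ?a"
    by (simp add: field_simps)
  also have "\<dots> = 2 * real M * exp (k * (\<eta> + 2 * \<eta>\<^sup>2) - \<eta> * (\<Sum>p\<in>S. 1 / real p))"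
    by (simp add: exp_minus exp_diff divide_inverse)
  finally show ?thesis .
qed

section \<open>A Mertens-type lower bound for the sum of prime reciprocals\<close>

lemma sum_inverse_squares_le: "(\<Sum>b\<in>{1..N}. 1 / real b ^ 2) \<le> 2"
proof -
  \<comment> \<open>The sharper bound 2 - 1/N makes the induction telescope.\<close>
  have "(\<Sum>b\<in>{1..N}. 1 / real b ^ 2) \<le> 2 - 1 / real N" if "N > 0"
    using that
  proof (induction N rule: nat_induct_non_zero)
    case (Suc n)
    have "1 / real (Suc n) ^ 2 \<le> 1 / (real n * real (Suc n))"
      unfolding power2_eq_square using Suc by (intro divide_left_mono mult_right_mono) auto
    also have "\<dots> = 1 / real n - 1 / real (Suc n)"
      using Suc by (simp add: field_simps)
    finally have "1 / real (Suc n) ^ 2 \<le> 1 / real n - 1 / real (Suc n)" .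
    with Suc show ?case
      by simp
  qed auto
  thus ?thesis
    by (cases "N = 0") (auto intro: order.trans)
qed

text \<open>A squarefree number is the product of its set of prime factors, so distinct
  \<open>a\<close> correspond to distinct sets of primes up to \<open>N\<close>; expanding the
  product on the right gives a nonnegative term for every such set.\<close>

lemma sum_inverse_squarefree_le:
  "(\<Sum>a | a \<in> {1..N} \<and> squarefree a. 1 / real a) \<le> (\<Prod>p | prime p \<and> p \<le> N. 1 + 1 / real p)"
proof -
  let ?S = "{p. prime p \<and> p \<le> N}" and ?A = "{a. a \<in> {1..N} \<and> squarefree a}"
  have rep: "\<Prod>(prime_factors a) = a" if "a \<in> ?A" for a
  proof -
    have "a \<noteq> 0" "squarefree a"
      using that by auto
    have "(\<Prod>p\<in>prime_factors a. p ^ multiplicity p a) = a"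
      using \<open>a \<noteq> 0\<close> by (simp add: prod_prime_factors)
    moreover have "multiplicity p a = 1" if "p \<in> prime_factors a" for p
      using that \<open>squarefree a\<close> \<open>a \<noteq> 0\<close> by (auto simp: squarefree_factorial_semiring')
    ultimately show ?thesis
      by simp
  qed
  have inj: "inj_on prime_factors ?A"
    by (rule inj_on_inverseI[where g = "\<lambda>T. \<Prod>T"]) (rule rep)
  have sub: "prime_factors ` ?A \<subseteq> Pow ?S"
    by (auto simp: in_prime_factors_iff dest!: dvd_imp_le)
  have "(\<Sum>a\<in>?A. 1 / real a) = (\<Sum>a\<in>?A. \<Prod>p\<in>prime_factors a. 1 / real p)"
  proof (intro sum.cong refl)
    fix a assume "a \<in> ?A"
    have "(\<Prod>p\<in>prime_factors a. 1 / real p) = 1 / real (\<Prod>(prime_factors a))"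
      by (simp add: prod_dividef)
    thus "1 / real a = (\<Prod>p\<in>prime_factors a. 1 / real p)"
      using rep[OF \<open>a \<in> ?A\<close>] by simp
  qed
  also have "\<dots> = (\<Sum>T\<in>prime_factors ` ?A. \<Prod>p\<in>T. 1 / real p)"
    using inj by (simp add: sum.reindex)
  also have "\<dots> \<le> (\<Sum>T\<in>Pow ?S. \<Prod>p\<in>T. 1 / real p)"
    using sub by (intro sum_mono2) (auto intro!: prod_nonneg)
  also have "\<dots> = (\<Prod>p\<in>?S. 1 / real p + 1)"
    by (subst prod_add) auto
  finally show ?thesis
    by (simp add: add.commute)
qed

text \<open>Splitting off the square part, at the cost of the factor 2, leaves factors 1 + 1/p in
  place of 1 / (1 - 1/p). These are at most exp (1/p) outright, with no second-order terms to
  control.\<close>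

lemma harm_le_prod_primes: "harm N \<le> 2 * (\<Prod>p | prime p \<and> p \<le> N. 1 + 1 / real p)"
proof -
  let ?A = "{a. a \<in> {1..N} \<and> squarefree a}"
  let ?f = "\<lambda>n :: nat. (squarefree_part n, square_part n)"
  have inj: "inj_on ?f {1..N}"
  proof (rule inj_onI)
    fix m n assume "?f m = ?f n"
    thus "m = n"
      using squarefree_decompose[of m] squarefree_decompose[of n] by simp
  qed
  have sub: "?f ` {1..N} \<subseteq> ?A \<times> {1..N}"
  proof
    fix x assume "x \<in> ?f ` {1..N}"
    then obtain n where n: "x = ?f n" "n \<in> {1..N}"
      by auto
    have "squarefree_part n * square_part n ^ 2 dvd n"
      using squarefree_decompose[of n] by simp
    hence "squarefree_part n dvd n" "square_part n dvd n"
      unfolding power2_eq_square by (auto dest: dvd_mult_left dvd_mult_right)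
    hence "squarefree_part n \<le> n" "square_part n \<le> n"
      using n by (auto intro: dvd_imp_le)
    moreover have "squarefree_part n > 0" "square_part n > 0"
      using n by (auto intro!: Nat.gr0I)
    ultimately show "x \<in> ?A \<times> {1..N}"
      using n by (auto simp: Suc_le_eq)
  qed
  \<comment> \<open>Write \<open>n = a b\<^sup>2\<close> with \<open>a\<close> squarefree; the sum over \<open>b\<close> is bounded.\<close>
  have "harm N = (\<Sum>n\<in>{1..N}. case ?f n of (a, b) \<Rightarrow> 1 / real a * (1 / real b ^ 2))"
    unfolding harm_def
  proof (intro sum.cong refl)
    fix n :: nat
    have "real n = real (squarefree_part n) * real (square_part n) ^ 2"
      using arg_cong[OF squarefree_decompose[of n], of real] by simp
    thus "inverse (real n) = (case ?f n of (a, b) \<Rightarrow> 1 / real a * (1 / real b ^ 2))"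
      by (simp add: divide_inverse)
  qed
  also have "\<dots> = (\<Sum>(a, b)\<in>?f ` {1..N}. 1 / real a * (1 / real b ^ 2))"
    using inj by (simp add: sum.reindex)
  also have "\<dots> \<le> (\<Sum>(a, b)\<in>?A \<times> {1..N}. 1 / real a * (1 / real b ^ 2))"
    using sub by (intro sum_mono2) auto
  also have "\<dots> = (\<Sum>a\<in>?A. 1 / real a) * (\<Sum>b\<in>{1..N}. 1 / real b ^ 2)"
    by (simp add: sum_product sum.cartesian_product)
  also have "\<dots> \<le> (\<Prod>p | prime p \<and> p \<le> N. 1 + 1 / real p) * 2"
    by (intro mult_mono sum_inverse_squarefree_le sum_inverse_squares_le)
       (auto intro!: sum_nonneg prod_nonneg)
  finally show ?thesis
    by simp
qed

text \<open>Euler's argument: ln y is at most a harmonic sum, hence at most 2 exp (sum of 1/p); the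
  result follows by taking logarithms.\<close>

lemma sum_inverse_primes_ge:
  fixes y :: real
  assumes "y > 1"
  shows "(\<Sum>p | prime p \<and> real p \<le> y. 1 / real p) \<ge> ln (ln y) - ln 2"
proof -
  let ?N = "nat \<lfloor>y\<rfloor>"
  have S: "{p. prime p \<and> real p \<le> y} = {p. prime p \<and> p \<le> ?N}"
    using assms by (auto simp: le_nat_iff le_floor_iff)
  \<comment> \<open>Rounding \<open>y\<close> down costs nothing, since the harmonic sum up to
    \<open>?N\<close> dominates ln (\<open>?N\<close> + 1).\<close>
  have "y \<le> real ?N + 1"
    using assms by linarith
  hence "ln y \<le> ln (real ?N + 1)"
    using assms by (intro ln_mono) auto
  also have "\<dots> \<le> harm ?N"
    by (rule ln_le_harm)
  also have "\<dots> \<le> 2 * (\<Prod>p | prime p \<and> p \<le> ?N. 1 + 1 / real p)"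
    by (rule harm_le_prod_primes)
  also have "\<dots> \<le> 2 * (\<Prod>p | prime p \<and> p \<le> ?N. exp (1 / real p))"
    by (intro mult_left_mono prod_mono) (auto intro: add_nonneg_nonneg)
  also have "(\<Prod>p | prime p \<and> p \<le> ?N. exp (1 / real p)) = exp (\<Sum>p | prime p \<and> p \<le> ?N. 1 / real p)"
    by (subst exp_sum) auto
  finally have "ln y / 2 \<le> exp (\<Sum>p | prime p \<and> real p \<le> y. 1 / real p)"
    unfolding S by simp
  hence "ln (ln y / 2) \<le> (\<Sum>p | prime p \<and> real p \<le> y. 1 / real p)"
    using assms ln_mono[of "ln y / 2"] by fastforce
  thus ?thesis
    using assms by (simp add: ln_div)
qed

section \<open>Transfer from [-M, M) to all integers with |D| < X\<close>

text \<open>There are at most y such primes, each at most y, and y ln y \<le> y^2. This crude bound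
  is enough because it will be used with y^2 = ln X.\<close>

lemma prod_primes_le:
  fixes y :: real
  assumes "y \<ge> 1"
  shows "real (\<Prod>{p. prime p \<and> real p \<le> y}) \<le> exp (y\<^sup>2)"
proof -
  let ?S = "{p :: nat. prime p \<and> real p \<le> y}"
  have sub: "?S \<subseteq> {1..nat \<lfloor>y\<rfloor>}"
    using assms by (auto simp: le_nat_iff le_floor_iff Suc_le_eq prime_gt_0_nat)
  have "card ?S \<le> nat \<lfloor>y\<rfloor>"
    using card_mono[OF _ sub] by simp
  hence card: "real (card ?S) \<le> y"
    using assms by linarith
  have "real (\<Prod>?S) \<le> (\<Prod>p\<in>?S. y)"
    unfolding of_nat_prod by (intro prod_mono) auto
  also have "\<dots> = exp (real (card ?S) * ln y)"
    using assms by (simp add: exp_of_nat_mult)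
  also have "real (card ?S) * ln y \<le> y * y"
    using assms card ln_bound[of y] by (intro mult_mono) auto
  finally show ?thesis
    by (simp add: power2_eq_square)
qed

lemma card_few_prime_divisors_upto_le:
  fixes X k \<eta> :: real
  assumes "X > 0" and X: "ln X > 1" and k: "k \<ge> 0" and \<eta>: "0 \<le> \<eta>" "\<eta> \<le> 1 / 2"
  shows "real (card {D. \<bar>real_of_int D\<bar> < X \<and> real (omega_upto (ln X) D) < k})
           \<le> 4 * X * exp (k * (\<eta> + 2 * \<eta>\<^sup>2) - \<eta> * (ln (ln (ln X)) - 2))"
proof -
  \<comment> \<open>The square root keeps the product of the primes up to \<open>y\<close> below
    \<open>X\<close>, yet lowers the iterated logarithm only by ln 2.\<close>
  define y where "y = sqrt (ln X)"
  define S where "S = {p :: nat. prime p \<and> real p \<le> y}"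
  define M where "M = \<Prod>S * nat \<lceil>X / real (\<Prod>S)\<rceil>"
  have y: "y > 1" "y\<^sup>2 = ln X"
    using X by (auto simp: y_def)
  have finS: "finite S"
    by (rule finite_subset[of _ "{..nat \<lfloor>y\<rfloor>}"]) (auto simp: S_def le_nat_iff le_floor_iff)
  have primeS: "p \<in> S \<Longrightarrow> prime p" for p
    by (simp add: S_def)
  have posS: "\<Prod>S > 0"
    by (intro prod_pos) (auto simp: S_def prime_gt_0_nat)
  have leX: "real (\<Prod>S) \<le> X"
    using prod_primes_le[of y] y \<open>X > 0\<close> by (simp add: S_def)
  define c where "c = real (nat \<lceil>X / real (\<Prod>S)\<rceil>)"
  have c: "X / real (\<Prod>S) \<le> c" "c \<le> X / real (\<Prod>S) + 1"
    using \<open>X > 0\<close> posS unfolding c_def by (simp_all del: of_nat_prod)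
  have M_c: "real M = real (\<Prod>S) * c"
    unfolding M_def c_def by (rule of_nat_mult)
  \<comment> \<open>Rounding \<open>X\<close> up to a multiple of the product of \<open>S\<close>
    adds at most that product, which is at most \<open>X\<close>.\<close>
  have M: "X \<le> real M" "real M \<le> 2 * X"
    using mult_left_mono[OF c(1), of "real (\<Prod>S)"] mult_left_mono[OF c(2), of "real (\<Prod>S)"] posS leX
    unfolding M_c by (simp_all del: of_nat_prod add: algebra_simps)
  \<comment> \<open>Ignoring the primes between \<open>y\<close> and ln X only lowers the count, so
    an integer with few prime divisors up to ln X also has few in \<open>S\<close>.\<close>
  have omega: "card {p\<in>S. int p dvd D} \<le> omega_upto (ln X) D" for D
    unfolding omega_upto_def
  proof (rule card_mono)
    show "finite {p :: nat. prime p \<and> real p \<le> ln X \<and> int p dvd D}"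
      by (rule finite_subset[of _ "{..nat \<lfloor>ln X\<rfloor>}"]) (auto simp: le_nat_iff le_floor_iff)
    have "y \<le> ln X"
      using y mult_left_mono[of 1 y y] by (simp add: power2_eq_square)
    thus "{p\<in>S. int p dvd D} \<subseteq> {p. prime p \<and> real p \<le> ln X \<and> int p dvd D}"
      by (auto simp: S_def)
  qed
  have "{D. \<bar>real_of_int D\<bar> < X \<and> real (omega_upto (ln X) D) < k}
          \<subseteq> {n \<in> {- int M..<int M}. real (card {p\<in>S. int p dvd n}) < k}"
  proof safe
    fix D assume D: "\<bar>real_of_int D\<bar> < X" "real (omega_upto (ln X) D) < k"
    show "D \<in> {- int M..<int M}"
      using D(1) M(1) by auto
    show "real (card {p\<in>S. int p dvd D}) < k"
      using D(2) omega[of D] by linarith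
  qed
  hence "real (card {D. \<bar>real_of_int D\<bar> < X \<and> real (omega_upto (ln X) D) < k})
          \<le> real (card {n \<in> {- int M..<int M}. real (card {p\<in>S. int p dvd n}) < k})"
    by (intro of_nat_mono card_mono finite_Collect_conjI disjI1) simp_all
  also have "\<dots> \<le> 2 * real M * exp (k * (\<eta> + 2 * \<eta>\<^sup>2) - \<eta> * (\<Sum>p\<in>S. 1 / real p))"
    by (rule card_few_prime_divisors_le[OF finS primeS _ k \<eta>]) (auto simp: M_def)
  also have "\<dots> \<le> 4 * X * exp (k * (\<eta> + 2 * \<eta>\<^sup>2) - \<eta> * (ln (ln (ln X)) - 2))"
  proof (rule mult_mono)
    \<comment> \<open>One ln 2 comes from the square root, the other from the bound for prime
      reciprocals; together they are at most 2.\<close>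
    have "ln (ln y) = ln (ln (ln X)) - ln 2"
      using X by (simp add: y_def ln_sqrt ln_div)
    moreover have "ln (2 :: real) \<le> 1"
      using ln_le_minus_one[of "2 :: real"] by simp
    ultimately have "ln (ln (ln X)) - 2 \<le> (\<Sum>p\<in>S. 1 / real p)"
      using sum_inverse_primes_ge[OF y(1)] by (simp add: S_def)
    thus "exp (k * (\<eta> + 2 * \<eta>\<^sup>2) - \<eta> * (\<Sum>p\<in>S. 1 / real p))
          \<le> exp (k * (\<eta> + 2 * \<eta>\<^sup>2) - \<eta> * (ln (ln (ln X)) - 2))"
      using \<eta> by (simp add: mult_left_mono)
  qed (use M \<open>X > 0\<close> in auto)
  finally show ?thesis .
qed

section \<open>The trivial count and the two ranges of \<epsilon>\<close>

lemma int_abs_less_subset: "{D. \<bar>real_of_int D\<bar> < X} \<subseteq> {- \<lfloor>X\<rfloor>..\<lfloor>X\<rfloor>}"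
  by (auto simp: le_floor_iff minus_le_iff)

lemma finite_int_abs_less: "finite {D. \<bar>real_of_int D\<bar> < X}"
  by (rule finite_subset[OF int_abs_less_subset]) simp

lemma card_int_abs_less_le:
  assumes "X \<ge> 1"
  shows "real (card {D. \<bar>real_of_int D\<bar> < X}) \<le> 3 * X"
proof -
  have "card {D. \<bar>real_of_int D\<bar> < X} \<le> card {- \<lfloor>X\<rfloor>..\<lfloor>X\<rfloor>}"
    by (intro card_mono int_abs_less_subset) simp
  hence "real (card {D. \<bar>real_of_int D\<bar> < X}) \<le> real (nat (2 * \<lfloor>X\<rfloor> + 1))"
    by simp
  also have "\<dots> \<le> 3 * X"
    using assms by linarith
  finally show ?thesis .
qed

theorem theorem3p8:
  fixes \<epsilon> :: real
  assumes "\<epsilon> > 0" and "\<epsilon> \<notin> {1/2..<1}"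
  shows "\<exists>g :: real \<Rightarrow> real. g \<in> O(\<lambda>X. ln (ln (ln X)) powr (1 - \<epsilon>)) \<and>
           (\<lambda>X. real (card {D. fundamental_discriminant D \<and> \<bar>real_of_int D\<bar> < X \<and>
                  \<not> real (omega_upto (ln X) D) \<ge> ln (ln (ln X)) - g X}))
             \<in> O(\<lambda>X. X / ln (ln (ln X)) powr (1 - \<epsilon>))"
proof -
  \<comment> \<open>For 1/2 \<le> \<epsilon> < 1 the Rankin bound exp (- L^(1 - 2\<epsilon>)/8) does
    not decay, while the target still demands a saving over O(X).\<close>
  consider "\<epsilon> \<ge> 1" | "\<epsilon> < 1 / 2"
    using assms by fastforce
  thus ?thesis
  proof cases
    case 1
    have "(\<lambda>X. real (card {D. fundamental_discriminant D \<and> \<bar>real_of_int D\<bar> < X \<and>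
                  \<not> real (omega_upto (ln X) D) \<ge> ln (ln (ln X)) - 0}))
             \<in> O(\<lambda>X. X / ln (ln (ln X)) powr (1 - \<epsilon>))"
    proof (rule bigoI[of _ 3])
      have "eventually (\<lambda>X :: real. X \<ge> 1) at_top" "eventually (\<lambda>X :: real. ln (ln (ln X)) \<ge> 1) at_top"
        by real_asymp+
      thus "eventually (\<lambda>X. norm (real (card {D. fundamental_discriminant D \<and> \<bar>real_of_int D\<bar> < X \<and>
                  \<not> real (omega_upto (ln X) D) \<ge> ln (ln (ln X)) - 0}))
             \<le> 3 * norm (X / ln (ln (ln X)) powr (1 - \<epsilon>))) at_top"
      proof eventually_elim
        case (elim X)
        \<comment> \<open>The exponent is at most 0, so the target is at least \<open>X\<close> and
          the trivial count is enough, even with \<open>g\<close> = 0.\<close>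
        have "ln (ln (ln X)) powr (1 - \<epsilon>) \<le> 1"
          using elim 1 powr_mono[of "1 - \<epsilon>" 0 "ln (ln (ln X))"] by simp
        hence X: "X \<le> X / ln (ln (ln X)) powr (1 - \<epsilon>)"
          using elim by (simp add: le_divide_eq mult_left_le)
        have "card {D. fundamental_discriminant D \<and> \<bar>real_of_int D\<bar> < X \<and>
                  \<not> real (omega_upto (ln X) D) \<ge> ln (ln (ln X)) - 0} \<le> card {D. \<bar>real_of_int D\<bar> < X}"
          by (intro card_mono finite_int_abs_less) auto
        with card_int_abs_less_le[of X] elim X show ?case
          by simp
      qed
    qed
    thus ?thesis
      by (intro exI[of _ "\<lambda>_. 0"]) auto
  next
    case 2
    let ?L = "\<lambda>X :: real. ln (ln (ln X))"
    define g where "g = (\<lambda>X. ?L X powr (1 - \<epsilon>))"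
    have "(\<lambda>X. real (card {D. fundamental_discriminant D \<and> \<bar>real_of_int D\<bar> < X \<and>
                  \<not> real (omega_upto (ln X) D) \<ge> ?L X - g X}))
             \<in> O(\<lambda>X. 4 * X * exp (1 - ?L X powr (1 - 2 * \<epsilon>) / 8))"
    proof (rule bigoI[of _ 1])
      have "eventually (\<lambda>X :: real. X \<ge> 1) at_top" "eventually (\<lambda>X :: real. ln X > 1) at_top"
           "eventually (\<lambda>X :: real. ?L X \<ge> 1) at_top"
        by real_asymp+
      thus "eventually (\<lambda>X. norm (real (card {D. fundamental_discriminant D \<and> \<bar>real_of_int D\<bar> < X \<and>
                  \<not> real (omega_upto (ln X) D) \<ge> ?L X - g X}))
             \<le> 1 * norm (4 * X * exp (1 - ?L X powr (1 - 2 * \<epsilon>) / 8))) at_top"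
      proof eventually_elim
        case (elim X)
        define L where "L = ?L X"
        \<comment> \<open>With \<eta> = c L^(-\<epsilon>) the main saving is (c - 2 c^2) L^(1 -
          2\<epsilon>), which is largest at c = 1/4, with value L^(1 - 2\<epsilon>)/8.\<close>
        define \<eta> where "\<eta> = L powr (- \<epsilon>) / 4"
        have L: "L \<ge> 1"
          using elim by (simp add: L_def)
        have "L powr (- \<epsilon>) \<le> 1"
          using L assms(1) powr_mono[of "- \<epsilon>" 0 L] by simp
        hence \<eta>: "0 \<le> \<eta>" "\<eta> \<le> 1 / 4"
          by (auto simp: \<eta>_def)
        have g_eq: "g X = L powr (1 - \<epsilon>)"
          by (simp add: g_def L_def)
        have "L powr (1 - \<epsilon>) \<le> L powr 1"
          using L assms(1) by (intro powr_mono) auto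
        hence gL: "g X \<le> L" "0 \<le> g X"
          using L by (auto simp: g_eq)
        have \<eta>_g: "\<eta> * g X = L powr (1 - 2 * \<epsilon>) / 4"
          by (simp add: \<eta>_def g_eq flip: powr_add)
        have "L * L powr (- \<epsilon>) * L powr (- \<epsilon>) = L powr (1 + - \<epsilon> + - \<epsilon>)"
          unfolding powr_add using L by simp
        hence L_\<eta>2: "L * \<eta>\<^sup>2 = L powr (1 - 2 * \<epsilon>) / 16"
          by (simp add: \<eta>_def power2_eq_square algebra_simps)
        have "{D. fundamental_discriminant D \<and> \<bar>real_of_int D\<bar> < X \<and> \<not> real (omega_upto (ln X) D) \<ge> ?L X - g X}
            \<subseteq> {D. \<bar>real_of_int D\<bar> < X \<and> real (omega_upto (ln X) D) < L - g X}"
          by (auto simp: L_def)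
        hence "card {D. fundamental_discriminant D \<and> \<bar>real_of_int D\<bar> < X \<and> \<not> real (omega_upto (ln X) D) \<ge> ?L X - g X}
            \<le> card {D. \<bar>real_of_int D\<bar> < X \<and> real (omega_upto (ln X) D) < L - g X}"
          by (intro card_mono finite_subset[OF _ finite_int_abs_less[of X]]) auto
        hence "real (card {D. fundamental_discriminant D \<and> \<bar>real_of_int D\<bar> < X \<and> \<not> real (omega_upto (ln X) D) \<ge> ?L X - g X})
            \<le> 4 * X * exp ((L - g X) * (\<eta> + 2 * \<eta>\<^sup>2) - \<eta> * (L - 2))"
          using card_few_prime_divisors_upto_le[of X "L - g X" \<eta>] elim gL \<eta> by (simp add: L_def)
        \<comment> \<open>The first-order terms \<eta> L cancel, leaving the gain \<eta> g against
          the quadratic loss 2 L \<eta>^2.\<close>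
        also have "(L - g X) * (\<eta> + 2 * \<eta>\<^sup>2) - \<eta> * (L - 2)
            = 2 * (L * \<eta>\<^sup>2) - \<eta> * g X - 2 * (g X * \<eta>\<^sup>2) + 2 * \<eta>"
          by (simp add: algebra_simps)
        \<comment> \<open>The main terms give 1/8 - 1/4 = - 1/8; the term in g \<eta>^2 is dropped
          by its sign, and 2 \<eta> \<le> 1/2.\<close>
        also have "\<dots> \<le> 1 - L powr (1 - 2 * \<epsilon>) / 8"
          unfolding \<eta>_g L_\<eta>2 using \<eta> mult_nonneg_nonneg[OF gL(2) zero_le_power2[of \<eta>]] by simp
        finally show ?case
          using elim by (simp add: L_def)
      qed
    qed
    also have "(\<lambda>X. 4 * X * exp (1 - ?L X powr (1 - 2 * \<epsilon>) / 8)) \<in> O(\<lambda>X. X / ?L X powr (1 - \<epsilon>))"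
    proof -
      \<comment> \<open>A positive power of L in the exponent beats every fixed power of L. The
        estimate is proved in the variable L and then composed with the triple logarithm, which
        tends to infinity.\<close>
      have "1 - 2 * \<epsilon> > 0"
        using 2 by simp
      hence "(\<lambda>L :: real. exp (1 - L powr (1 - 2 * \<epsilon>) / 8)) \<in> O(\<lambda>L. 1 / L powr (1 - \<epsilon>))"
        by real_asymp
      moreover have "filterlim ?L at_top at_top"
        by real_asymp
      ultimately have "(\<lambda>X. exp (1 - ?L X powr (1 - 2 * \<epsilon>) / 8)) \<in> O(\<lambda>X. 1 / ?L X powr (1 - \<epsilon>))"
        by (rule landau_o.big.compose)
      hence "(\<lambda>X. 4 * X * exp (1 - ?L X powr (1 - 2 * \<epsilon>) / 8)) \<in> O(\<lambda>X. X * (1 / ?L X powr (1 - \<epsilon>)))"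
        by (intro landau_o.big.mult) simp_all
      thus ?thesis
        by simp
    qed
    finally show ?thesis
      by (intro exI[of _ g]) (auto simp: g_def)
  qed
qed

end
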